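(* For $k=2$ and every real $c<\frac{3+\sqrt{17}}{2}$, no deterministic online algorithm for the $2$-Canadian Traveller Problem with predictions is $c$-competitive, even when restricted to instances whose prediction error is at most $1$ and whose graph is path-disjoint.
   Context: $k$-Canadian Traveller Problem ($k$-CTP) with predictions: an instance consists of a connected undirected graph $G=(V,E)$, a source $s$, a destination $t$, a nonnegative cost function $c:E\to\mathbb{R}^+$, an unknown set $B\subseteq E$ of blocked edges with $|B|\le k$ such that $G-B$ contains an $s$-$t$ path, and a predicted set $B_p\subseteq E$ of blocked edges with $|B_p|\le k$. The traveller knows $G,c,s,t,k,B_p$ in advance, starts at $s$, and learns whether an edge is blocked only upon reaching one of its endpoints; blocked edges cannot be traversed. $ALG$ is the total cost travelled, $OPT$ the cost of a shortest $s$-$t$ path in $G-B$. A deterministic algorithm is $c$-competitive if $ALG\le c\cdot OPT$ on every instance. The prediction error is $|B\triangle B_p|$. A graph is path-disjoint if all its $s$-$t$ paths are pairwise node-disjoint apart from $s$ and $t$. *)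

theory Defs
  imports Complex_Main "HOL-Library.Extended_Real"
begin

text \<open>An undirected edge is the two-element set of its endpoints. A path is given by the list of
  its vertices.\<close>

definition path_between :: "'v set set \<Rightarrow> 'v \<Rightarrow> 'v \<Rightarrow> 'v list \<Rightarrow> bool" where
  "path_between E u v p \<longleftrightarrow>
     p \<noteq> [] \<and> hd p = u \<and> last p = v \<and> distinct p \<and> successively (\<lambda>x y. {x, y} \<in> E) p"

fun walk_cost :: "('v set \<Rightarrow> real) \<Rightarrow> 'v list \<Rightarrow> real" where
  "walk_cost w (u # v # p) = w {u, v} + walk_cost w (v # p)"
| "walk_cost w _ = 0"

text \<open>The part of an instance that the traveller knows in advance. The set of edges that are
  actually blocked is not part of it and is passed separately as \<open>B\<close>.\<close>

record 'v ctp_input =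
  verts :: "'v set"
  edges :: "'v set set"
  cost :: "'v set \<Rightarrow> real"
  source :: 'v
  dest :: 'v
  max_blocked :: nat
  predicted :: "'v set set"

definition ctp_instance :: "'v ctp_input \<Rightarrow> 'v set set \<Rightarrow> bool" where
  "ctp_instance I B \<longleftrightarrow>
     finite (verts I) \<and>
     edges I \<subseteq> {{u, v} | u v. u \<in> verts I \<and> v \<in> verts I \<and> u \<noteq> v} \<and>
     (\<forall>u\<in>verts I. \<forall>v\<in>verts I. \<exists>p. path_between (edges I) u v p) \<and>
     source I \<in> verts I \<and> dest I \<in> verts I \<and>
     (\<forall>e\<in>edges I. 0 \<le> cost I e) \<and>
     predicted I \<subseteq> edges I \<and> card (predicted I) \<le> max_blocked I \<and>
     B \<subseteq> edges I \<and> card B \<le> max_blocked I \<and>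
     (\<exists>p. path_between (edges I - B) (source I) (dest I) p)"

definition path_disjoint :: "'v ctp_input \<Rightarrow> bool" where
  "path_disjoint I \<longleftrightarrow>
     (\<forall>p q. path_between (edges I) (source I) (dest I) p \<and>
            path_between (edges I) (source I) (dest I) q \<and> p \<noteq> q \<longrightarrow>
            set p \<inter> set q \<subseteq> {source I, dest I})"

definition prediction_error :: "'v ctp_input \<Rightarrow> 'v set set \<Rightarrow> nat" where
  "prediction_error I B = card (sym_diff B (predicted I))"

definition opt_cost :: "'v ctp_input \<Rightarrow> 'v set set \<Rightarrow> real" where
  "opt_cost I B =
     Min (walk_cost (cost I) ` {p. path_between (edges I - B) (source I) (dest I) p})"

text \<open>A deterministic online algorithm chooses the next vertex from the advance knowledge, the
  sequence of vertices visited so far, and the blocked edges revealed so far, which are those with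
  a visited endpoint. The order in which statuses were revealed is determined by these data.\<close>

type_synonym 'v ctp_algorithm = "'v ctp_input \<Rightarrow> 'v list \<Rightarrow> 'v set set \<Rightarrow> 'v"

definition revealed :: "'v set set \<Rightarrow> 'v list \<Rightarrow> 'v set set" where
  "revealed B xs = {e \<in> B. e \<inter> set xs \<noteq> {}}"

text \<open>The vertices visited in the first \<open>n\<close> moves; \<open>None\<close> once the algorithm has chosen a move that
  is not along an unblocked edge.\<close>

primrec run :: "'v ctp_algorithm \<Rightarrow> 'v ctp_input \<Rightarrow> 'v set set \<Rightarrow> nat \<Rightarrow> 'v list option" where
  "run A I B 0 = Some [source I]"
| "run A I B (Suc n) =
     (case run A I B n of
        None \<Rightarrow> None
      | Some xs \<Rightarrow>
          (let v = A I xs (revealed B xs)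
           in if {last xs, v} \<in> edges I - B then Some (xs @ [v]) else None))"

definition reaches_dest_at :: "'v ctp_algorithm \<Rightarrow> 'v ctp_input \<Rightarrow> 'v set set \<Rightarrow> nat \<Rightarrow> bool" where
  "reaches_dest_at A I B n \<longleftrightarrow> (\<exists>xs. run A I B n = Some xs \<and> last xs = dest I)"

text \<open>The traveller stops on first arrival at the destination. An algorithm that never arrives has
  infinite cost.\<close>

definition alg_cost :: "'v ctp_algorithm \<Rightarrow> 'v ctp_input \<Rightarrow> 'v set set \<Rightarrow> ereal" where
  "alg_cost A I B =
     (if \<exists>n. reaches_dest_at A I B n
      then ereal (walk_cost (cost I) (the (run A I B (LEAST n. reaches_dest_at A I B n))))
      else \<infinity>)"

definition competitive_on ::
  "('v ctp_input \<times> 'v set set) set \<Rightarrow> 'v ctp_algorithm \<Rightarrow> real \<Rightarrow> bool" where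
  "competitive_on S A c \<longleftrightarrow> (\<forall>(I, B)\<in>S. alg_cost A I B \<le> ereal (c * opt_cost I B))"

text \<open>\<^const>\<open>opt_cost\<close> is the minimum of a finite nonempty set on every instance.\<close>

lemma finite_paths:
  assumes "ctp_instance I B"
  shows "finite {p. path_between (edges I - B) (source I) (dest I) p}"
proof (rule finite_subset)
  have fin: "finite (verts I)" and E: "edges I \<subseteq> {{u, v} | u v. u \<in> verts I \<and> v \<in> verts I \<and> u \<noteq> v}"
    and s: "source I \<in> verts I"
    using assms by (auto simp: ctp_instance_def)
  show "finite {p. set p \<subseteq> verts I \<and> distinct p}"
    using finite_subset_distinct[OF fin] .
  have in_verts: "set p \<subseteq> verts I"
    if "successively (\<lambda>x y. {x, y} \<in> edges I - B) p" "p \<noteq> []" "hd p \<in> verts I" for p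
    using that
  proof (induction p rule: induct_list012)
    case (3 x y zs)
    have "{x, y} \<in> edges I" using 3(3) by simp
    then obtain u v where "{x, y} = {u, v}" "u \<in> verts I" "v \<in> verts I" using E by blast
    then have "{x, y} \<subseteq> verts I" by simp
    then show ?case using 3 by auto
  qed auto
  show "{p. path_between (edges I - B) (source I) (dest I) p} \<subseteq> {p. set p \<subseteq> verts I \<and> distinct p}"
  proof clarify
    fix p assume p: "path_between (edges I - B) (source I) (dest I) p"
    have "set p \<subseteq> verts I"
      by (rule in_verts) (use p s in \<open>auto simp only: path_between_def\<close>)
    then show "set p \<subseteq> verts I \<and> distinct p" using p by (simp only: path_between_def)
  qed
qed

end

theory Submission imports Defs begin

text \<open>Take three internally disjoint \<open>s\<close>-\<open>t\<close> paths through \<open>1\<close>, \<open>2\<close>, \<open>3\<close>, of costs \<open>1\<close>, \<open>x\<close>, \<open>x\<close>,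
  with all the cost on the edge at \<open>s\<close>, and predict that exactly the last edge of the cheap path is
  blocked. If the algorithm first leaves \<open>s\<close> for an expensive path, nothing is blocked and its ratio is
  at least \<open>x\<close>. If it first tries the cheap path, that path is blocked together with the expensive path
  it tries first, so it pays at least \<open>2 + 2 x + x\<close> while the optimum is \<open>x\<close>. The two ratios \<open>x\<close> and
  \<open>3 + 2 / x\<close> coincide for \<open>x = (3 + sqrt 17) / 2\<close>.\<close>

section \<open>Walk costs and runs of an algorithm\<close>

lemma walk_cost_snoc:
  "xs \<noteq> [] \<Longrightarrow> walk_cost w (xs @ [v]) = walk_cost w xs + w {last xs, v}"
  by (induction w xs rule: walk_cost.induct) auto

lemma walk_cost_nonneg: "(\<And>e. 0 \<le> w e) \<Longrightarrow> 0 \<le> walk_cost w xs"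
  by (induction w xs rule: walk_cost.induct) auto

lemma revealed_insert:
  "revealed (insert e B) xs = (if e \<inter> set xs = {} then revealed B xs else insert e (revealed B xs))"
  unfolding revealed_def by auto

lemma run_SomeD:
  assumes "run A I B n = Some xs"
  shows "xs \<noteq> []" "hd xs = source I" "successively (\<lambda>u v. {u, v} \<in> edges I - B) xs"
  using assms
  by (induction n arbitrary: xs)
     (auto simp: Let_def successively_append_iff split: option.splits if_splits)

lemma run_mono:
  assumes "run A I B n = Some xs" "m \<le> n"
  shows "\<exists>ys zs. run A I B m = Some ys \<and> xs = ys @ zs"
  using assms(2,1)
  by (induction n arbitrary: xs rule: dec_induct)
     (fastforce simp: Let_def split: option.splits if_splits)+

text \<open>The bound is a real number, which excludes the infinite cost of never arriving, so the
  run up to the first arrival is a witness.\<close>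

lemma competitive_onD:
  assumes "competitive_on S A c" "(I, B) \<in> S"
  obtains n xs where "run A I B n = Some xs" "last xs = dest I"
    "walk_cost (cost I) xs \<le> c * opt_cost I B"
proof -
  have le: "alg_cost A I B \<le> ereal (c * opt_cost I B)"
    using assms by (auto simp: competitive_on_def)
  then have ex: "\<exists>n. reaches_dest_at A I B n"
    by (auto simp: alg_cost_def split: if_splits)
  define n where "n = (LEAST n. reaches_dest_at A I B n)"
  have "reaches_dest_at A I B n"
    unfolding n_def using ex by (rule LeastI_ex)
  then obtain xs where xs: "run A I B n = Some xs" "last xs = dest I"
    by (auto simp: reaches_dest_at_def)
  have "walk_cost (cost I) xs \<le> c * opt_cost I B"
    using le ex xs by (simp add: alg_cost_def flip: n_def)
  with xs show thesis by (rule that)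
qed

section \<open>The three-path instance\<close>

definition theta_edges :: "nat set set" where
  "theta_edges = {{0, 1}, {0, 2}, {0, 3}, {1, 4}, {2, 4}, {3, 4}}"

text \<open>The source is \<open>0\<close> and the destination \<open>4\<close>. Testing for
  \<open>4\<close> first makes \<open>{1, 4}\<close> free, so the whole price of a path is paid
  before its last edge is seen to be blocked.\<close>

definition theta_cost :: "real \<Rightarrow> nat set \<Rightarrow> real" where
  "theta_cost x e = (if 4 \<in> e then 0 else if 1 \<in> e then 1 else x)"

definition theta_input :: "real \<Rightarrow> nat ctp_input" where
  "theta_input x = \<lparr>verts = {0, 1, 2, 3, 4}, edges = theta_edges, cost = theta_cost x,
     source = 0, dest = 4, max_blocked = 2, predicted = {{1, 4}}\<rparr>"

lemma theta_input_simps [simp]: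
  "verts (theta_input x) = {0, 1, 2, 3, 4}" "edges (theta_input x) = theta_edges"
  "cost (theta_input x) = theta_cost x" "source (theta_input x) = 0" "dest (theta_input x) = 4"
  "max_blocked (theta_input x) = 2" "predicted (theta_input x) = {{1, 4}}"
  by (simp_all add: theta_input_def)

lemma theta_edges_iff:
  "{u, v} \<in> theta_edges \<longleftrightarrow>
     u \<in> {0, 4} \<and> v \<in> {1, 2, 3} \<or> u \<in> {1, 2, 3} \<and> v \<in> {0, 4}"
  by (auto simp: theta_edges_def doubleton_eq_iff)

text \<open>A middle vertex is adjacent only to \<open>0\<close> and \<open>4\<close>, and
  distinctness forbids returning to \<open>0\<close>. A general \<open>B\<close> serves both
  path-disjointness and the optima.\<close>

lemma path_between_theta:
  "path_between (theta_edges - B) 0 4 p \<longleftrightarrow>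
     (\<exists>i\<in>{1, 2, 3}. p = [0, i, 4] \<and> {0, i} \<notin> B \<and> {i, 4} \<notin> B)"
proof
  assume p: "path_between (theta_edges - B) 0 4 p"
  then obtain q where q: "p = 0 # q" "q \<noteq> []"
    by (cases p) (auto simp: path_between_def split: if_splits)
  then obtain i r where r: "q = i # r"
    by (cases q) auto
  with p q have i: "i \<in> {1, 2, 3}"
    by (auto simp: path_between_def theta_edges_iff)
  then obtain j r' where j: "r = j # r'"
    using p q r by (cases r) (auto simp: path_between_def)
  have "{i, j} \<in> theta_edges" "j \<noteq> 0"
    using p q r j by (auto simp: path_between_def)
  then have "j = 4"
    using i by (auto simp: theta_edges_iff)
  moreover from this have "r' = []"
    using p q r j by (cases r' rule: rev_cases) (auto simp: path_between_def)
  ultimately show "\<exists>i\<in>{1, 2, 3}. p = [0, i, 4] \<and> {0, i} \<notin> B \<and> {i, 4} \<notin> B"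
    using p q r j i by (auto simp: path_between_def)
qed (auto simp: path_between_def theta_edges_iff)

lemma opt_cost_theta_blocked:
  fixes j k :: nat
  assumes "j = 2 \<and> k = 3 \<or> j = 3 \<and> k = 2"
  shows "opt_cost (theta_input x) {{1, 4}, {j, 4}} = x"
proof -
  have paths: "{p. path_between (theta_edges - {{1, 4}, {j, 4}}) 0 4 p} = {[0, k, 4]}"
    using assms unfolding path_between_theta
    by (elim disjE conjE) (simp_all add: doubleton_eq_iff)
  show ?thesis
    unfolding opt_cost_def theta_input_simps paths using assms by (auto simp: theta_cost_def)
qed

lemma path_disjoint_theta: "path_disjoint (theta_input x)"
  unfolding path_disjoint_def theta_input_simps path_between_theta[of "{}", unfolded Diff_empty]
  by auto

lemma theta_connected:
  assumes "u \<in> {0, 1, 2, 3, 4}" "v \<in> {0, 1, 2, 3, 4}"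
  shows "\<exists>p. path_between theta_edges u v p"
proof -
  consider "u = v" | "{u, v} \<in> theta_edges" "u \<noteq> v"
    | "u \<in> {1, 2, 3}" "v \<in> {1, 2, 3}" "u \<noteq> v" | "u \<in> {0, 4}" "v \<in> {0, 4}" "u \<noteq> v"
    using assms by (auto simp: theta_edges_iff)
  then show ?thesis
  proof cases
    case 1
    then have "path_between theta_edges u v [u]" by (simp add: path_between_def)
    then show ?thesis ..
  next
    case 2
    then have "path_between theta_edges u v [u, v]" by (simp add: path_between_def)
    then show ?thesis ..
  next
    case 3
    then have "path_between theta_edges u v [u, 0, v]"
      by (auto simp: path_between_def theta_edges_iff)
    then show ?thesis ..
  next
    case 4
    then have "path_between theta_edges u v [u, 1, v]"
      by (auto simp: path_between_def theta_edges_iff)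
    then show ?thesis ..
  qed
qed

lemma ctp_instance_theta:
  assumes "0 \<le> x" "B \<subseteq> theta_edges" "card B \<le> 2" "i \<in> {1, 2, 3}" "{0, i} \<notin> B" "{i, 4} \<notin> B"
  shows "ctp_instance (theta_input x) B"
proof -
  let ?E = "{{u, v} | u v. u \<in> {0, 1, 2, 3, 4 :: nat} \<and> v \<in> {0, 1, 2, 3, 4} \<and> u \<noteq> v}"
  have "{u, v} \<in> ?E" if "u \<in> {0, 1, 2, 3, 4}" "v \<in> {0, 1, 2, 3, 4}" "u \<noteq> v" for u v
    using that by blast
  then have "theta_edges \<subseteq> ?E"
    unfolding theta_edges_def by (intro insert_subsetI empty_subsetI) simp_all
  moreover have "\<exists>p. path_between (theta_edges - B) 0 4 p"
    using assms unfolding path_between_theta by blast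
  moreover have "{{1, 4}} \<subseteq> theta_edges"
    by (simp add: theta_edges_def)
  moreover have "\<forall>u\<in>{0, 1, 2, 3, 4}. \<forall>v\<in>{0, 1, 2, 3, 4}. \<exists>p. path_between theta_edges u v p"
    using theta_connected by blast
  moreover have "\<forall>e\<in>theta_edges. 0 \<le> theta_cost x e" "card {{1, 4 :: nat}} \<le> 2"
    "finite {0, 1, 2, 3, 4 :: nat}" "0 \<in> {0, 1, 2, 3, 4 :: nat}" "4 \<in> {0, 1, 2, 3, 4 :: nat}"
    using assms(1) by (simp_all add: theta_cost_def)
  ultimately show ?thesis
    unfolding ctp_instance_def theta_input_simps using assms(2,3) by argo
qed

section \<open>Cost of a walk when two paths are blocked\<close>

text \<open>The vertices \<open>1\<close> and \<open>j\<close> are dead ends here, so the edge to each of them is paid twice unless the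
  walk is still there.\<close>

lemma theta_walk_cost:
  fixes xs :: "nat list"
  assumes jk: "j = 2 \<and> k = 3 \<or> j = 3 \<and> k = 2" and x: "0 \<le> x"
    and "xs \<noteq> []" "hd xs = 0"
    and "successively (\<lambda>u v. {u, v} \<in> theta_edges - {{1, 4}, {j, 4}}) xs"
  shows "(if 1 \<in> set xs then if last xs = 1 then 1 else 2 else 0)
       + (if j \<in> set xs then if last xs = j then x else 2 * x else 0)
       + (if k \<in> set xs then x else 0) \<le> walk_cost (theta_cost x) xs
     \<and> (4 \<in> set xs \<longrightarrow> k \<in> set xs)"
  using assms(3-)
proof (induction xs rule: rev_induct)
  case (snoc v xs)
  show ?case
  proof (cases "xs = []")
    case True
    then show ?thesis using snoc.prems jk by auto
  next
    case False
    have step: "{last xs, v} \<in> theta_edges" "{last xs, v} \<noteq> {1, 4}" "{last xs, v} \<noteq> {j, 4}"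
      and IH: "(if 1 \<in> set xs then if last xs = 1 then 1 else 2 else 0)
       + (if j \<in> set xs then if last xs = j then x else 2 * x else 0)
       + (if k \<in> set xs then x else 0) \<le> walk_cost (theta_cost x) xs"
        "4 \<in> set xs \<longrightarrow> k \<in> set xs"
      using snoc False by (auto simp: successively_append_iff)
    have last: "last xs \<in> set xs" using False by simp
    \<comment> \<open>The blocked edges leave \<open>0\<close> as the only exit from
      \<open>1\<close> and \<open>j\<close>; retracing that edge pays for the increase of the bound.
      Vertex \<open>4\<close> is entered only from \<open>k\<close>.\<close>
    consider "last xs = 0" "v = 1" | "last xs = 0" "v = j" | "last xs = 0" "v = k"
      | "last xs = 1" "v = 0" | "last xs = j" "v = 0" | "last xs = k" "v = 0"
      | "last xs = k" "v = 4" | "last xs = 4" "v = k"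
      using step jk by (auto simp: theta_edges_iff insert_commute)
    then show ?thesis
      unfolding walk_cost_snoc[OF False]
      using jk IH last x
      by cases (elim disjE conjE; simp add: theta_cost_def split: if_splits)+
  qed
qed simp

section \<open>Indistinguishability of the two blocked instances\<close>

text \<open>Until the algorithm visits \<open>2\<close> or \<open>3\<close>, it cannot tell which of the two paths through them is
  blocked. The conclusion also covers runs that have already failed.\<close>

lemma theta_runs_agree:
  fixes A :: "nat ctp_algorithm" and x :: real
  defines "R \<equiv> \<lambda>j. run A (theta_input x) {{1, 4}, {j, 4}}"
  shows "R 2 n = R 3 n \<and> (\<forall>xs. R 2 n = Some xs \<longrightarrow> set xs \<subseteq> {0, 1}) \<or>
    (\<forall>xs. R 2 n = Some xs \<longrightarrow> 2 \<in> set xs) \<or> (\<forall>xs. R 3 n = Some xs \<longrightarrow> 3 \<in> set xs)"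
proof (induction n)
  case 0
  show ?case by (simp add: R_def)
next
  case (Suc n)
  \<comment> \<open>Runs only grow or fail, so the last two alternatives persist.\<close>
  have keep: "\<forall>xs. R j (Suc n) = Some xs \<longrightarrow> i \<in> set xs"
    if "\<forall>xs. R j n = Some xs \<longrightarrow> i \<in> set xs" for i j
    using that by (auto simp: R_def Let_def split: option.splits if_splits)
  show ?case
  proof (cases "R 2 n")
    case None
    then show ?thesis by (simp add: R_def)
  next
    case (Some xs)
    show ?thesis
    proof (cases "R 3 n = Some xs \<and> set xs \<subseteq> {0, 1}")
      case True
      have rev: "revealed {{1, 4}, {3, 4}} xs = revealed {{1, 4}, {2, 4}} xs"
      proof -
        have "{2, 4} \<inter> set xs = {}" "{3, 4} \<inter> set xs = {}" using True by auto
        then show ?thesis by (simp add: revealed_insert)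
      qed
      have "xs \<noteq> []" using run_SomeD(1) Some unfolding R_def by blast
      then have "last xs \<in> {0, 1}" using True last_in_set by blast
      \<comment> \<open>The edge that differs is not at the current vertex either, so the same moves
        are legal in both runs.\<close>
      then have ends: "{last xs, v} \<noteq> {2, 4}" "{last xs, v} \<noteq> {3, 4}" for v
        by (auto simp: doubleton_eq_iff)
      define v where "v = A (theta_input x) xs (revealed {{1, 4}, {2, 4}} xs)"
      have step: "R j (Suc n) = (if {last xs, v} \<in> theta_edges - {{1, 4}} then Some (xs @ [v]) else None)"
        if "j \<in> {2, 3}" for j
      proof -
        have "{last xs, v} \<in> theta_edges - {{1, 4}, {j, 4}} \<longleftrightarrow> {last xs, v} \<in> theta_edges - {{1, 4}}"
          using that ends[of v] by blast
        moreover have "revealed {{1, 4}, {j, 4}} xs = revealed {{1, 4}, {2, 4}} xs"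
          using that rev by blast
        moreover have "run A (theta_input x) {{1, 4}, {j, 4}} n = Some xs"
          using that Some True unfolding R_def by blast
        ultimately show ?thesis by (simp only: R_def v_def run.simps option.case Let_def theta_input_simps)
      qed
      \<comment> \<open>A common move to \<open>2\<close> gives the second alternative, one to
        \<open>3\<close> the third.\<close>
      have "v \<in> {0, 1} \<or> v = 2 \<or> v = 3" if "{last xs, v} \<in> theta_edges" "{last xs, v} \<noteq> {1, 4}"
        using that \<open>last xs \<in> {0, 1}\<close> by (elim insertE) (auto simp: theta_edges_iff)
      then show ?thesis
        using True step[of 2] step[of 3] by (cases "{last xs, v} \<in> theta_edges - {{1, 4}}") auto
    next
      case False
      then have "(\<forall>xs. R 2 n = Some xs \<longrightarrow> 2 \<in> set xs) \<or> (\<forall>xs. R 3 n = Some xs \<longrightarrow> 3 \<in> set xs)"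
        using Suc Some by auto
      then show ?thesis using keep by blast
    qed
  qed
qed

text \<open>At the earlier of the two arrival times one run already contains \<open>4\<close>, so
  the runs can no longer agree within \<open>{0, 1}\<close>.\<close>

lemma theta_tries_blocked_path:
  fixes A :: "nat ctp_algorithm" and x :: real
  assumes "run A (theta_input x) {{1, 4}, {2, 4}} m = Some xs" "last xs = 4"
    and "run A (theta_input x) {{1, 4}, {3, 4}} n = Some ys" "last ys = 4"
  shows "2 \<in> set xs \<or> 3 \<in> set ys"
proof -
  define l where "l = min m n"
  obtain xs' xs'' where xs: "run A (theta_input x) {{1, 4}, {2, 4}} l = Some xs'" "xs = xs' @ xs''"
    using run_mono[OF assms(1), of l] by (auto simp: l_def)
  obtain ys' ys'' where ys: "run A (theta_input x) {{1, 4}, {3, 4}} l = Some ys'" "ys = ys' @ ys''"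
    using run_mono[OF assms(3), of l] by (auto simp: l_def)
  have "xs' = xs \<or> ys' = ys"
    using assms(1,3) xs(1) ys(1) by (auto simp: l_def min_def split: if_splits)
  then have "4 \<in> set xs' \<or> 4 \<in> set ys'"
    using assms(2,4) run_SomeD(1)[OF xs(1)] run_SomeD(1)[OF ys(1)] by (metis last_in_set)
  then show ?thesis
    using theta_runs_agree[of A x l] xs ys by auto
qed

section \<open>The adversary argument\<close>

theorem theorem11:
  fixes c :: real and A :: "nat ctp_algorithm"
  assumes "c < (3 + sqrt 17) / 2"
  shows "\<not> competitive_on
           {(I, B). ctp_instance I B \<and> max_blocked I = 2 \<and>
                    prediction_error I B \<le> 1 \<and> path_disjoint I}
           A c"
proof
  let ?S = "{(I, B). ctp_instance I B \<and> max_blocked I = 2 \<and>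
                     prediction_error I B \<le> 1 \<and> path_disjoint I}"
  assume comp: "competitive_on ?S A c"
  define x where "x = (3 + sqrt 17) / 2"
  let ?I = "theta_input x"
  have x: "1 < x" "x * x = 3 * x + 2"
  proof -
    define r where "r = sqrt 17"
    have "0 \<le> r" "r * r = 17" by (simp_all add: r_def)
    then show "1 < x" "x * x = 3 * x + 2"
      unfolding x_def r_def[symmetric] by (simp_all add: field_simps)
  qed
  have cx: "c < x" using assms by (simp add: x_def)
  \<comment> \<open>No candidate blocked edge touches \<open>0\<close>, so the first move is the
    same for all these \<open>B\<close>.\<close>
  have starts: "\<exists>zs. xs = 0 # A ?I [0] {} # zs"
    if run: "run A ?I B n = Some xs" "last xs = 4" and B: "B \<subseteq> {{1, 4}, {2, 4}, {3, 4}}" for B n xs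
  proof -
    have "n \<noteq> 0" using run by (cases n) auto
    then obtain ys zs where "run A ?I B (Suc 0) = Some ys" "xs = ys @ zs"
      using run_mono[OF run(1), of "Suc 0"] by auto
    moreover have "revealed B [0] = {}"
      using B by (auto simp: revealed_def)
    ultimately show ?thesis by (auto simp: Let_def split: if_splits)
  qed

  have paths: "{p. path_between (theta_edges - {}) 0 4 p} = {[0, 1, 4], [0, 2, 4], [0, 3, 4]}"
    unfolding path_between_theta by auto
  have opt0: "opt_cost ?I {} = 1"
    unfolding opt_cost_def theta_input_simps paths using x by (simp add: theta_cost_def)
  have "(?I, {}) \<in> ?S"
    using x path_disjoint_theta ctp_instance_theta[of x "{}" 1] by (simp add: prediction_error_def)
  from competitive_onD[OF comp this]
  obtain n xs where xs: "run A ?I {} n = Some xs" "last xs = 4" "walk_cost (theta_cost x) xs \<le> c"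
    unfolding opt0 theta_input_simps mult_1_right .
  obtain zs where zs: "xs = 0 # A ?I [0] {} # zs"
    using starts[OF xs(1,2)] by auto
  \<comment> \<open>Any other first edge already costs \<open>x\<close>, more than \<open>c\<close>
    times the optimum \<open>1\<close>.\<close>
  have first: "A ?I [0] {} = 1"
  proof (rule ccontr)
    assume "A ?I [0] {} \<noteq> 1"
    moreover have "A ?I [0] {} \<in> {1, 2, 3}"
      using run_SomeD(3)[OF xs(1)] zs by (auto simp: theta_edges_iff)
    ultimately have "x \<le> walk_cost (theta_cost x) xs"
      using zs walk_cost_nonneg[of "theta_cost x" "A ?I [0] {} # zs"] x
      by (auto simp: theta_cost_def)
    with xs(3) cx show False by simp
  qed

  have fails: "\<exists>n xs. run A ?I {{1, 4}, {j, 4}} n = Some xs \<and> last xs = 4 \<and> j \<notin> set xs"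
    if jk: "j = 2 \<and> k = 3 \<or> j = 3 \<and> k = 2" for j k :: nat
  proof -
    let ?B = "{{1, 4}, {j, 4}}"
    have "ctp_instance ?I ?B"
      using x jk by (intro ctp_instance_theta[where i = k])
        (auto simp: theta_edges_def doubleton_eq_iff card_insert_if)
    \<comment> \<open>The prediction is right about \<open>{1, 4}\<close> and misses only
      \<open>{j, 4}\<close>.\<close>
    moreover have "sym_diff ?B {{1, 4}} = {{j, 4}}"
      using jk by (auto simp: doubleton_eq_iff)
    ultimately have "(?I, ?B) \<in> ?S"
      using path_disjoint_theta by (simp add: prediction_error_def)
    from competitive_onD[OF comp this]
    obtain n xs where xs: "run A ?I ?B n = Some xs" "last xs = 4"
      "walk_cost (theta_cost x) xs \<le> c * x"
      unfolding opt_cost_theta_blocked[OF jk] theta_input_simps .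
    have ne: "xs \<noteq> []" using run_SomeD(1)[OF xs(1)] .
    have "1 \<in> set xs" using starts[OF xs(1,2)] jk first by auto
    moreover have "4 \<in> set xs" using ne xs(2) last_in_set by fastforce
    moreover have "last xs \<noteq> 1" "last xs \<noteq> j" using xs(2) jk by auto
    moreover have "0 \<le> x" "c * x < x * x" using cx x(1) by simp_all
    \<comment> \<open>Visiting \<open>j\<close> as well would cost at least
      \<open>2 + 2 * x + x = x * x\<close>, which exceeds \<open>c * x\<close>; the single
      \<open>x\<close> is for \<open>k\<close>, the only way to \<open>4\<close>.\<close>
    ultimately have "j \<notin> set xs"
      using theta_walk_cost[OF jk _ ne, of x] run_SomeD(2,3)[OF xs(1)] x(2) xs(3) by auto
    with xs show ?thesis by blast
  qed
  obtain m ys where "run A ?I {{1, 4}, {2, 4}} m = Some ys" "last ys = 4" "2 \<notin> set ys"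
    using fails[of 2 3] by auto
  moreover obtain n zs where "run A ?I {{1, 4}, {3, 4}} n = Some zs" "last zs = 4" "3 \<notin> set zs"
    using fails[of 3 2] by auto
  ultimately show False
    using theta_tries_blocked_path by blast
qed

end
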